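(* Let $(\mathcal P,\mathcal O)$ be a 3-twined semitopology and $f,f':\mathcal P\to\mathbf 3$. Then $$\mathsf{Quorum} f\wedge\mathsf{Quorum} f'\le\mathsf{Contraquorum}(f\wedge f').$$ As a corollary, if $\mathsf{Quorum} f\wedge\mathsf{Quorum} f'$ is valid then $\mathsf{Contraquorum}(f\wedge f')$ is valid.
   Context: Truth values: $\mathbf 3=\{\mathbf f,\mathbf b,\mathbf t\}$ totally ordered by $\mathbf f<\mathbf b<\mathbf t$; $\wedge$ is min, $\bigwedge,\bigvee$ are infimum and supremum; $(f\wedge f')(p)=f(p)\wedge f'(p)$. A truth value is valid iff it lies in $\{\mathbf t,\mathbf b\}$. A semitopology $(\mathcal P,\mathcal O)$ is a set $\mathcal P$ with a family $\mathcal O$ of subsets containing $\mathcal P$ and closed under arbitrary (including empty) unions; $\mathcal O^{\neq\emptyset}$ is the set of nonempty members. It is 3-twined if any three members of $\mathcal O^{\neq\emptyset}$ have nonempty intersection. For $f:\mathcal P\to\mathbf 3$: $\mathsf{Quorum} f=\bigvee_{O\in\mathcal O^{\neq\emptyset}}\bigwedge_{p\in O}f(p)$ and $\mathsf{Contraquorum} f=\bigwedge_{O\in\mathcal O^{\neq\emptyset}}\bigvee_{p\in O}f(p)$. *)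

theory Defs
  imports Main
begin

datatype tv = tvF | tvB | tvT

instantiation tv :: linorder
begin

definition less_eq_tv :: "tv \<Rightarrow> tv \<Rightarrow> bool" where
  "x \<le> y \<longleftrightarrow> x = tvF \<or> y = tvT \<or> x = y"

definition less_tv :: "tv \<Rightarrow> tv \<Rightarrow> bool" where
  "x < y \<longleftrightarrow> x \<le> y \<and> x \<noteq> (y :: tv)"

instance
proof
  fix x y z :: tv
  show "x < y \<longleftrightarrow> x \<le> y \<and> \<not> y \<le> x"
    by (cases x; cases y) (simp_all add: less_tv_def less_eq_tv_def)
  show "x \<le> x"
    by (simp add: less_eq_tv_def)
  show "x \<le> y \<Longrightarrow> y \<le> z \<Longrightarrow> x \<le> z"
    by (cases x; cases y; cases z) (simp_all add: less_eq_tv_def)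
  show "x \<le> y \<Longrightarrow> y \<le> x \<Longrightarrow> x = y"
    by (cases x; cases y) (simp_all add: less_eq_tv_def)
  show "x \<le> y \<or> y \<le> x"
    by (cases x; cases y) (simp_all add: less_eq_tv_def)
qed

end

instantiation tv :: complete_linorder
begin

definition inf_tv :: "tv \<Rightarrow> tv \<Rightarrow> tv" where
  "inf_tv = min"

definition sup_tv :: "tv \<Rightarrow> tv \<Rightarrow> tv" where
  "sup_tv = max"

definition bot_tv :: tv where
  "bot_tv = tvF"

definition top_tv :: tv where
  "top_tv = tvT"

definition Inf_tv :: "tv set \<Rightarrow> tv" where
  "Inf_tv A = (if tvF \<in> A then tvF else if tvB \<in> A then tvB else tvT)"

definition Sup_tv :: "tv set \<Rightarrow> tv" where
  "Sup_tv A = (if tvT \<in> A then tvT else if tvB \<in> A then tvB else tvF)"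

instance
proof
  fix x y z :: tv and A :: "tv set"
  show "inf x y \<le> x" "inf x y \<le> y"
    by (simp_all add: inf_tv_def)
  show "x \<le> y \<Longrightarrow> x \<le> z \<Longrightarrow> x \<le> inf y z"
    by (simp add: inf_tv_def)
  show "x \<le> sup x y" "y \<le> sup x y"
    by (simp_all add: sup_tv_def)
  show "y \<le> x \<Longrightarrow> z \<le> x \<Longrightarrow> sup y z \<le> x"
    by (simp add: sup_tv_def)
  show "x \<in> A \<Longrightarrow> Inf A \<le> x"
    by (cases x) (auto simp: Inf_tv_def less_eq_tv_def)
  show "x \<in> A \<Longrightarrow> x \<le> Sup A"
    by (cases x) (auto simp: Sup_tv_def less_eq_tv_def)
  show "(\<And>y. y \<in> A \<Longrightarrow> x \<le> y) \<Longrightarrow> x \<le> Inf A"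
    by (cases x) (force simp: Inf_tv_def less_eq_tv_def)+
  show "(\<And>y. y \<in> A \<Longrightarrow> y \<le> x) \<Longrightarrow> Sup A \<le> x"
    by (cases x) (force simp: Sup_tv_def less_eq_tv_def)+
  show "Inf {} = (top :: tv)" "Sup {} = (bot :: tv)"
    by (simp_all add: Inf_tv_def Sup_tv_def top_tv_def bot_tv_def)
qed

end

definition valid :: "tv \<Rightarrow> bool" where
  "valid v \<longleftrightarrow> v \<in> {tvT, tvB}"

definition semitopology :: "'p set \<Rightarrow> 'p set set \<Rightarrow> bool" where
  "semitopology P Opn \<longleftrightarrow>
     Opn \<subseteq> Pow P \<and> P \<in> Opn \<and> (\<forall>\<X>. \<X> \<subseteq> Opn \<longrightarrow> \<Union>\<X> \<in> Opn)"

definition nonempty_opens :: "'p set set \<Rightarrow> 'p set set" where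
  "nonempty_opens Opn = {U \<in> Opn. U \<noteq> {}}"

definition three_twined :: "'p set set \<Rightarrow> bool" where
  "three_twined Opn \<longleftrightarrow>
     (\<forall>U \<in> nonempty_opens Opn. \<forall>V \<in> nonempty_opens Opn. \<forall>W \<in> nonempty_opens Opn.
        U \<inter> V \<inter> W \<noteq> {})"

text \<open>A map from the points of a semitopology to the truth values is given by a total function
  on the underlying type; only its values on the carrier enter the following two definitions,
  since every open set is a subset of the carrier.\<close>

definition Quorum :: "'p set set \<Rightarrow> ('p \<Rightarrow> tv) \<Rightarrow> tv" where
  "Quorum Opn f = (SUP U \<in> nonempty_opens Opn. INF p \<in> U. f p)"

definition Contraquorum :: "'p set set \<Rightarrow> ('p \<Rightarrow> tv) \<Rightarrow> tv" where
  "Contraquorum Opn f = (INF U \<in> nonempty_opens Opn. SUP p \<in> U. f p)"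

end

theory Submission
  imports Defs
begin

text \<open>Any opens \<open>U\<close>, \<open>V\<close> witnessing the two quorums and any
  \<open>W\<close> tested by the contraquorum share a point \<open>p\<close>, by 3-twinedness. The
  value \<open>inf (f p) (f' p)\<close> then separates the two sides
  (\<open>inf_Quorum_le_Contraquorum\<close>). The corollary holds because valid values are upward
  closed (\<open>valid_mono\<close>).\<close>

lemma valid_mono: "x \<le> y \<Longrightarrow> valid x \<Longrightarrow> valid y"
  by (auto simp: valid_def less_eq_tv_def)

lemma inf_Quorum_le_Contraquorum:
  assumes "three_twined Opn"
  shows "inf (Quorum Opn f) (Quorum Opn f') \<le> Contraquorum Opn (\<lambda>p. inf (f p) (f' p))"
  \<comment> \<open>Distributivity makes the left side a supremum over pairs \<open>U\<close>,
    \<open>V\<close>, so one triple \<open>U\<close>, \<open>V\<close>, \<open>W\<close> can be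
    treated at a time.\<close>
  unfolding Quorum_def Contraquorum_def SUP_inf_distrib2
proof (intro SUP_least INF_greatest)
  fix U V W
  assume "U \<in> nonempty_opens Opn" "V \<in> nonempty_opens Opn" "W \<in> nonempty_opens Opn"
  with assms obtain p where p: "p \<in> U" "p \<in> V" "p \<in> W"
    unfolding three_twined_def by blast
  have "inf (INF p\<in>U. f p) (INF p\<in>V. f' p) \<le> inf (f p) (f' p)"
    using p by (intro inf_mono INF_lower)
  also have "\<dots> \<le> (SUP p\<in>W. inf (f p) (f' p))"
    using p by (intro SUP_upper)
  finally show "inf (INF p\<in>U. f p) (INF p\<in>V. f' p) \<le> (SUP p\<in>W. inf (f p) (f' p))" .
qed

theorem theorem2p14:
  fixes P :: "'p set" and Opn :: "'p set set" and f f' :: "'p \<Rightarrow> tv"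
  assumes "semitopology P Opn"
    and "three_twined Opn"
  shows "inf (Quorum Opn f) (Quorum Opn f') \<le> Contraquorum Opn (\<lambda>p. inf (f p) (f' p)) \<and>
    (valid (inf (Quorum Opn f) (Quorum Opn f')) \<longrightarrow>
      valid (Contraquorum Opn (\<lambda>p. inf (f p) (f' p))))"
  using inf_Quorum_le_Contraquorum[OF assms(2)] valid_mono by blast

end
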